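(* Suppose $f(x,\theta)$ is continuously differentiable in $x$ for all $\theta\in\Theta$ and $g$ is continuously differentiable. Suppose: $\|\nabla_x f(x_1,\theta)-\nabla_x f(x_2,\theta)\|\le G_{f,x}\|x_1-x_2\|$ for all $x_1,x_2\in X$, $\theta\in\Theta$; $\nabla_\theta g$ is Lipschitz continuous with constant $G_g$; $X$ and $\Theta$ are compact; and $\|\nabla_x f(x,\theta_1)-\nabla_x f(x,\theta_2)\|\le G_{f,\theta}\|\theta_1-\theta_2\|$ for all $\theta_1,\theta_2\in\Theta$, $x\in X$. Suppose the solution set $\Theta^*=\operatorname{argmin}_{\theta\in\Theta}g(\theta)$ is weak sharp. Let $\gamma_{f,k}=\gamma_f$ and $\gamma_{g,k}=\gamma_g$ for all $k$ with $0<\gamma_f<2/G_{f,x}$ and $0<\gamma_g<2/G_g$, and let $\{(x_k,\theta_k)\}$ be generated by the joint gradient scheme. Then, as $k\to\infty$, $\{\theta_k\}$ converges to a point $\theta^*\in\Theta^*$ and $\{x_k\}$ converges to a point in $X^*=\operatorname{argmin}_{x\in X}f(x,\theta^* )$.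
   Context: $X\subseteq\mathbb{R}^n$ and $\Theta\subseteq\mathbb{R}^m$ are nonempty closed convex sets, $f:X\times\Theta\to\mathbb{R}$ is convex in $x$ for every $\theta\in\Theta$, and $g:\mathbb{R}^m\to\mathbb{R}$ is convex. $\Pi_Y$ denotes Euclidean projection onto $Y$. $\Theta^*$ is weak sharp if there is $\alpha>0$ with $g(\theta)-g(\theta^* )\ge\alpha\,\mathrm{dist}(\theta,\Theta^* )$ for all $\theta\in\Theta$ and $\theta^*\in\Theta^*$, where $\mathrm{dist}(\theta,\Theta^* )=\min_{\theta^*\in\Theta^*}\|\theta-\theta^*\|$. The joint gradient scheme, given $x_0\in X$, $\theta_0\in\Theta$ and steplengths $\{\gamma_{f,k}\},\{\gamma_{g,k}\}$, is: for all $k\ge0$, $x_{k+1}=\Pi_X(x_k-\gamma_{f,k}\nabla_x f(x_k,\theta_k))$ and $\theta_{k+1}=\Pi_\Theta(\theta_k-\gamma_{g,k}\nabla_\theta g(\theta_k))$. *)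

theory Defs
  imports "HOL-Analysis.Analysis"
begin

text \<open>Differentiability is relative to \<open>S\<close>, so only the values of \<open>h\<close> on \<open>S\<close> matter; a function that is
  C1 on an open neighbourhood of \<open>S\<close> is covered. If \<open>S\<close> has empty interior, \<open>G\<close> need not be unique,
  which is why the gradient is a parameter rather than a function of \<open>h\<close>.\<close>

definition C1_with_gradient_on ::
    "'a::real_inner set \<Rightarrow> ('a \<Rightarrow> real) \<Rightarrow> ('a \<Rightarrow> 'a) \<Rightarrow> bool" where
  "C1_with_gradient_on S h G \<longleftrightarrow>
     (\<forall>x\<in>S. (h has_derivative (\<lambda>v. G x \<bullet> v)) (at x within S)) \<and> continuous_on S G"

definition argmin_set :: "'a set \<Rightarrow> ('a \<Rightarrow> real) \<Rightarrow> 'a set" where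
  "argmin_set S h = {x. is_arg_min h (\<lambda>y. y \<in> S) x}"

definition weak_sharp ::
    "'a::metric_space set \<Rightarrow> ('a \<Rightarrow> real) \<Rightarrow> bool" where
  "weak_sharp S h \<longleftrightarrow>
     (\<exists>\<alpha>>0. \<forall>t\<in>S. \<forall>s\<in>argmin_set S h. h t - h s \<ge> \<alpha> * infdist t (argmin_set S h))"

definition joint_gradient_scheme ::
    "'a::euclidean_space set \<Rightarrow> 'b::euclidean_space set \<Rightarrow> ('a \<Rightarrow> 'b \<Rightarrow> 'a) \<Rightarrow> ('b \<Rightarrow> 'b) \<Rightarrow>
     (nat \<Rightarrow> real) \<Rightarrow> (nat \<Rightarrow> real) \<Rightarrow> (nat \<Rightarrow> 'a) \<Rightarrow> (nat \<Rightarrow> 'b) \<Rightarrow> bool" where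
  "joint_gradient_scheme X \<Theta> grad_f grad_g \<gamma>f \<gamma>g x \<theta> \<longleftrightarrow>
     x 0 \<in> X \<and> \<theta> 0 \<in> \<Theta> \<and>
     (\<forall>k. x (Suc k) = closest_point X (x k - \<gamma>f k *\<^sub>R grad_f (x k) (\<theta> k)) \<and>
          \<theta> (Suc k) = closest_point \<Theta> (\<theta> k - \<gamma>g k *\<^sub>R grad_g (\<theta> k)))"

end

(* A projected gradient step with error e satisfies a sufficient decrease inequality, which makes
   the squared step lengths summable, and a Fejer-type inequality whose only bad term is the squared
   step length. Hence no cocoercivity of the gradient is needed, which would be awkward on a set
   without interior, and summable errors suffice for convergence to a minimizer. For \<theta> there is no
   error, and weak sharpness turns the sum of both inequalities into geometric decay of d^2 + r / \<kappa>,
   where d is the distance of \<theta>_k to the minimizers and r = g(\<theta>_k) - min g. So the distances of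
   \<theta>_k to its limit t are summable, and relative to the limiting problem f(_, t) the x-iteration is
   a projected gradient method with summable errors. *)
theory Submission
  imports Defs
begin

section \<open>Minimizers and almost decreasing real sequences\<close>

lemma argmin_set_iff:
  fixes h :: "'a \<Rightarrow> real"
  shows "z \<in> argmin_set S h \<longleftrightarrow> z \<in> S \<and> (\<forall>y\<in>S. h z \<le> h y)"
  by (auto simp: argmin_set_def is_arg_min_linorder)

text \<open>Telescoping bounds the partial sums of \<open>b\<close> by
  \<open>a 0 + suminf c\<close>. Subtracting the partial sums of \<open>c\<close> from
  \<open>a\<close> leaves a decreasing sequence bounded below by \<open>- suminf c\<close>. With
  \<open>b\<close> as the squared steps or the objective gaps and \<open>c\<close> as the errors,
  this drives the convergence proof.\<close>

lemma quasi_decreasing: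
  fixes a b c :: "nat \<Rightarrow> real"
  assumes step: "\<And>k. a (Suc k) \<le> a k - b k + c k"
    and a: "\<And>k. 0 \<le> a k" and b: "\<And>k. 0 \<le> b k" and c: "\<And>k. 0 \<le> c k" "summable c"
  shows "summable b" and "convergent a"
proof -
  have cs: "(\<Sum>k<n. c k) \<le> suminf c" for n
    using c by (intro sum_le_suminf) auto
  have tele: "a n + (\<Sum>k<n. b k) \<le> a 0 + (\<Sum>k<n. c k)" for n
  proof (induction n)
    case (Suc n)
    then show ?case using step[of n] by simp
  qed simp
  show "summable b"
  proof (rule summableI_nonneg_bounded[OF b])
    show "(\<Sum>k<n. b k) \<le> a 0 + suminf c" for n
      using tele[of n] cs[of n] a[of n] by simp
  qed
  define A where "A n = a n - (\<Sum>k<n. c k)" for n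
  have "decseq A"
    unfolding decseq_Suc_iff
  proof
    show "A (Suc n) \<le> A n" for n
      using step[of n] b[of n] by (simp add: A_def)
  qed
  moreover have "- suminf c \<le> A n" for n
    using a[of n] cs[of n] by (simp add: A_def)
  ultimately obtain l where "A \<longlonglongrightarrow> l"
    using decseq_convergent by blast
  then have "(\<lambda>n. A n + (\<Sum>k<n. c k)) \<longlonglongrightarrow> l + suminf c"
    using c(2) by (intro tendsto_add summable_LIMSEQ)
  then show "convergent a"
    by (auto simp: A_def convergent_def)
qed

section \<open>Convex functions with Lipschitz gradient on a compact convex set\<close>

locale smooth_convex =
  fixes S :: "'a::euclidean_space set" and h :: "'a \<Rightarrow> real" and G :: "'a \<Rightarrow> 'a" and L :: real
  assumes S: "convex S" "compact S" "S \<noteq> {}"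
    and cvx: "convex_on S h"
    and deriv: "u \<in> S \<Longrightarrow> (h has_derivative (\<lambda>v. G u \<bullet> v)) (at u within S)"
    and lip: "u \<in> S \<Longrightarrow> v \<in> S \<Longrightarrow> norm (G u - G v) \<le> L * norm (u - v)"
begin

lemma cont: "continuous_on S h"
  using deriv by (rule has_derivative_continuous_on)

lemma closed_S: "closed S"
  using S compact_imp_closed by blast

lemma argmin_nonempty: "argmin_set S h \<noteq> {}"
proof -
  obtain z where "z \<in> S" "\<forall>y\<in>S. h z \<le> h y"
    using continuous_attains_inf[OF S(2,3) cont] by blast
  then have "z \<in> argmin_set S h" by (simp add: argmin_set_iff)
  then show ?thesis by blast
qed

lemma closed_argmin: "closed (argmin_set S h)"
proof -
  obtain z where z: "z \<in> S" "\<forall>y\<in>S. h z \<le> h y"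
    using argmin_nonempty by (auto simp: argmin_set_iff)
  then have "argmin_set S h = S \<inter> h -` {h z}"
    by (auto simp: argmin_set_iff intro!: antisym)
  then show ?thesis
    using continuous_closed_preimage[OF cont closed_S, of "{h z}"] by simp
qed

lemma segment_in:
  assumes "u \<in> S" "v \<in> S" "0 \<le> t" "t \<le> 1"
  shows "u + t *\<^sub>R (v - u) \<in> S"
  using convexD_alt[OF S(1) assms] by (simp add: algebra_simps)

text \<open>The segment stays in \<open>S\<close>, so the chain rule for derivatives relative to
  \<open>S\<close> applies even if \<open>S\<close> has empty interior.\<close>

lemma segment_deriv:
  assumes "u \<in> S" "v \<in> S" "t \<in> {0..1}"
  shows "((\<lambda>t. h (u + t *\<^sub>R (v - u))) has_derivative
           (\<lambda>s. s * (G (u + t *\<^sub>R (v - u)) \<bullet> (v - u)))) (at t within {0..1})"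
proof -
  have "((\<lambda>t. u + t *\<^sub>R (v - u)) has_derivative (\<lambda>s. s *\<^sub>R (v - u))) (at t within {0..1})"
    by (auto intro!: derivative_eq_intros)
  from has_derivative_in_compose2[OF _ _ _ this, where t = S and g = h and g' = "\<lambda>u v. G u \<bullet> v"]
  show ?thesis
    using segment_in[OF assms(1,2)] assms(3) deriv by (simp add: image_subset_iff)
qed

lemma segment_grad_bound:
  assumes "u \<in> S" "v \<in> S" "0 \<le> t" "t \<le> 1"
  shows "\<bar>G (u + t *\<^sub>R (v - u)) \<bullet> (v - u) - G u \<bullet> (v - u)\<bar> \<le> t * L * (norm (v - u))\<^sup>2"
proof -
  have "\<bar>(G (u + t *\<^sub>R (v - u)) - G u) \<bullet> (v - u)\<bar> \<le> norm (G (u + t *\<^sub>R (v - u)) - G u) * norm (v - u)"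
    by (rule Cauchy_Schwarz_ineq2)
  also have "\<dots> \<le> (L * norm (t *\<^sub>R (v - u))) * norm (v - u)"
    using lip[OF segment_in[OF assms] assms(1)] by (intro mult_right_mono) simp_all
  finally show ?thesis
    using assms by (simp add: inner_diff_left power2_eq_square mult_ac)
qed

text \<open>The mean value theorem is applied to \<open>h\<close> along the segment minus
  \<open>L / 2 * t^2\<close> times the squared length. The derivative of this quadratic cancels the
  bound of \<open>segment_grad_bound\<close> exactly, which gives the constant \<open>L / 2\<close>
  without integration; \<open>h\<close> alone would only give \<open>L\<close>.\<close>

lemma descent:
  assumes "u \<in> S" "v \<in> S"
  shows "h v \<le> h u + G u \<bullet> (v - u) + L / 2 * (norm (v - u))\<^sup>2"
proof -
  let ?n = "(norm (v - u))\<^sup>2"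
  have "\<exists>t\<in>{0..1}. (h (u + 1 *\<^sub>R (v - u)) - L / 2 * ?n * 1\<^sup>2) - (h (u + 0 *\<^sub>R (v - u)) - L / 2 * ?n * 0\<^sup>2)
     = (\<lambda>s. s * (G (u + t *\<^sub>R (v - u)) \<bullet> (v - u)) - L / 2 * ?n * (2 * t * s)) (1 - 0)"
    by (rule mvt_very_simple)
      (auto intro!: derivative_eq_intros segment_deriv assms simp: mult_ac)
  then obtain t where "t \<in> {0..1}" "h v - h u = G (u + t *\<^sub>R (v - u)) \<bullet> (v - u) - t * L * ?n + L / 2 * ?n"
    by (auto simp: algebra_simps)
  then show ?thesis
    using segment_grad_bound[OF assms, of t] by auto
qed

text \<open>Convexity at a point \<open>?w\<close> of the segment is combined with
  \<open>descent\<close> from \<open>?w\<close> back to \<open>u\<close>; dividing by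
  \<open>t\<close> and letting \<open>t\<close> tend to 0 leaves the tangent inequality.\<close>

lemma above_tangent:
  assumes "u \<in> S" "v \<in> S"
  shows "h u + G u \<bullet> (v - u) \<le> h v"
proof -
  \<comment> \<open>One half comes from \<open>descent\<close> between \<open>?w\<close> and
    \<open>u\<close>, the rest from replacing the gradient at \<open>?w\<close> by that at
    \<open>u\<close>.\<close>
  let ?C = "3 / 2 * (L * (norm (v - u))\<^sup>2)"
  have *: "G u \<bullet> (v - u) - t * ?C \<le> h v - h u" if t: "0 < t" "t < 1" for t
  proof -
    let ?w = "u + t *\<^sub>R (v - u)"
    have w: "?w \<in> S" using segment_in assms t by auto
    have "h ?w \<le> (1 - t) * h u + t * h v"
      using convex_onD[OF cvx, of t u v] assms t by (simp add: algebra_simps)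
    moreover have "h u \<le> h ?w - t * (G ?w \<bullet> (v - u)) + L / 2 * (t\<^sup>2 * (norm (v - u))\<^sup>2)"
      using descent[OF w assms(1)] by (simp add: power_mult_distrib)
    moreover have "t * (G u \<bullet> (v - u)) \<le> t * (G ?w \<bullet> (v - u) + t * L * (norm (v - u))\<^sup>2)"
      using segment_grad_bound[OF assms, of t] t by (intro mult_left_mono) auto
    ultimately have "t * (G u \<bullet> (v - u) - t * ?C) \<le> t * (h v - h u)"
      by (simp add: algebra_simps power2_eq_square)
    then show ?thesis using t by simp
  qed
  have "((\<lambda>t. G u \<bullet> (v - u) - t * ?C) \<longlongrightarrow> G u \<bullet> (v - u) - 0 * ?C) (at_right 0)"
    by (intro tendsto_intros)
  moreover have "\<forall>\<^sub>F t in at_right 0. G u \<bullet> (v - u) - t * ?C \<le> h v - h u"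
    using * by (auto simp: eventually_at_right_field intro: exI[of _ 1])
  ultimately show ?thesis
    using tendsto_upperbound by fastforce
qed

section \<open>One projected gradient step with gradient error \<open>e\<close>\<close>

context
  fixes \<gamma> :: real and u e v :: 'a
  assumes \<gamma>: "0 < \<gamma>" and u: "u \<in> S"
    and v: "v = closest_point S (u - \<gamma> *\<^sub>R (G u + e))"
begin

lemma step_in: "v \<in> S"
  unfolding v using closed_S S(3) by (rule closest_point_in_set)

text \<open>The obtuse angle property of the projection; the next two estimates use the projection
  only through this and \<open>step_in\<close>.\<close>

lemma step_obtuse:
  assumes "z \<in> S"
  shows "(u - v) \<bullet> (z - v) \<le> \<gamma> * (G u \<bullet> (z - v)) + \<gamma> * (e \<bullet> (z - v))"
  using closest_point_dot[OF S(1) closed_S assms, of "u - \<gamma> *\<^sub>R (G u + e)", folded v]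
  by (simp add: inner_simps algebra_simps)

text \<open>\<open>step_obtuse\<close> at \<open>z = u\<close> bounds the linear term in
  \<open>descent\<close>. For \<gamma> * L < 2 the coefficient of the squared step is a true
  decrease.\<close>

lemma step_descent: "h v \<le> h u - (1 / \<gamma> - L / 2) * (norm (v - u))\<^sup>2 + norm e * norm (v - u)"
proof -
  have "(u - v) \<bullet> (u - v) + \<gamma> * (G u \<bullet> (v - u)) \<le> \<gamma> * (e \<bullet> (u - v))"
    using step_obtuse[OF u] by (simp add: inner_simps algebra_simps)
  also have "\<dots> \<le> \<gamma> * (norm e * norm (v - u))"
    using norm_cauchy_schwarz[of e "u - v"] \<gamma> by (simp add: norm_minus_commute)
  finally have "(norm (v - u))\<^sup>2 / \<gamma> + G u \<bullet> (v - u) \<le> norm e * norm (v - u)"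
    using \<gamma> by (simp add: field_simps power2_norm_eq_inner inner_simps)
  then show ?thesis
    using descent[OF u step_in] by (simp add: algebra_simps)
qed

text \<open>The square is expanded around \<open>v\<close>. The gradient term splits at
  \<open>u\<close>: \<open>above_tangent\<close> handles the part towards \<open>z\<close> and
  \<open>descent\<close> the part towards \<open>v\<close>, so the gap appears at the new point
  \<open>v\<close>. The coefficient \<gamma> * L - 1 may be positive; that term is controlled by
  \<open>step_descent\<close>.\<close>

lemma step_fejer:
  assumes z: "z \<in> S"
  shows "(norm (v - z))\<^sup>2 \<le> (norm (u - z))\<^sup>2 + (\<gamma> * L - 1) * (norm (v - u))\<^sup>2
           + 2 * \<gamma> * (h z - h v) + 2 * \<gamma> * (norm e * norm (v - z))"
proof -
  have "(norm (v - z))\<^sup>2 = (norm (u - z))\<^sup>2 - (norm (v - u))\<^sup>2 + 2 * ((u - v) \<bullet> (z - v))"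
    by (simp add: power2_norm_eq_inner inner_simps algebra_simps inner_commute)
  moreover have "\<gamma> * (G u \<bullet> (z - v)) \<le> \<gamma> * (h z - h v + L / 2 * (norm (v - u))\<^sup>2)"
    using above_tangent[OF u z] descent[OF u step_in] \<gamma>
    by (intro mult_left_mono) (auto simp: inner_simps)
  moreover have "\<gamma> * (e \<bullet> (z - v)) \<le> \<gamma> * (norm e * norm (v - z))"
    using norm_cauchy_schwarz[of e "z - v"] \<gamma> by (simp add: norm_minus_commute)
  ultimately show ?thesis
    using step_obtuse[OF z] by (simp add: algebra_simps)
qed

end

section \<open>Convergence under summable errors\<close>

lemma norm_diff_bound:
  obtains D where "0 < D" "\<And>u v. u \<in> S \<Longrightarrow> v \<in> S \<Longrightarrow> norm (u - v) \<le> D"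
proof -
  \<comment> \<open>Adding 1 keeps the bound positive when \<open>S\<close> is a single
    point.\<close>
  have "norm (u - v) \<le> diameter S + 1" if "u \<in> S" "v \<in> S" for u v
    using diameter_bounded_bound[OF compact_imp_bounded[OF S(2)] that] by (simp add: dist_norm)
  moreover have "0 < diameter S + 1"
    using diameter_ge_0[OF compact_imp_bounded[OF S(2)]] by simp
  ultimately show ?thesis using that by blast
qed

lemma kappa_pos:
  assumes "0 < \<gamma>" "\<gamma> * L < 2"
  shows "0 < 1 / \<gamma> - L / 2"
  using assms by (simp add: field_simps)

text \<open>The values tend to the minimum, so a cluster point, which exists by compactness, is a
  minimizer. The distance to every minimizer converges, hence the distance to this one tends to 0
  along the whole sequence.\<close>

theorem perturbed_gradient_projection_converges:
  fixes x e :: "nat \<Rightarrow> 'a"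
  assumes \<gamma>: "0 < \<gamma>" "\<gamma> * L < 2"
    and x0: "x 0 \<in> S"
    and step: "\<And>k. x (Suc k) = closest_point S (x k - \<gamma> *\<^sub>R (G (x k) + e k))"
    and e: "summable (\<lambda>k. norm (e k))"
  obtains z where "z \<in> argmin_set S h" "x \<longlonglongrightarrow> z"
proof -
  define \<kappa> where "\<kappa> = 1 / \<gamma> - L / 2"
  have \<kappa>: "0 < \<kappa>" using kappa_pos[OF \<gamma>] by (simp add: \<kappa>_def)
  obtain D where D: "0 < D" "\<And>u v. u \<in> S \<Longrightarrow> v \<in> S \<Longrightarrow> norm (u - v) \<le> D"
    by (rule norm_diff_bound) blast
  have xS: "x k \<in> S" for k
  proof (induction k)
    case (Suc k) then show ?case using step_in[OF \<gamma>(1) _ step] by blast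
  qed (rule x0)
  \<comment> \<open>Boundedness of \<open>S\<close> turns the error terms of both step inequalities
    into multiples of \<open>norm (e k)\<close>.\<close>
  have err: "norm (e k) * norm (x j - y) \<le> D * norm (e k)" if "y \<in> S" for j k y
    using mult_right_mono[OF D(2)[OF xS that, of j] norm_ge_zero[of "e k"]] by (simp add: mult.commute)
  have De: "summable (\<lambda>k. D * norm (e k))"
    using e by (rule summable_mult)
  obtain z0 where z0: "z0 \<in> argmin_set S h" using argmin_nonempty by blast
  have "summable (\<lambda>k. \<kappa> * (norm (x (Suc k) - x k))\<^sup>2)"
  proof (rule quasi_decreasing)
    show "h (x (Suc k)) - h z0 \<le> h (x k) - h z0 - \<kappa> * (norm (x (Suc k) - x k))\<^sup>2 + D * norm (e k)" for k
      using step_descent[OF \<gamma>(1) xS step, of k] err[OF xS, of k "Suc k" k]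
      by (simp add: \<kappa>_def)
  qed (use z0 xS De D(1) \<kappa> in \<open>auto simp: argmin_set_iff\<close>)
  then have sq: "summable (\<lambda>k. (norm (x (Suc k) - x k))\<^sup>2)"
    using \<kappa> by (simp add: summable_cmult_iff)
  have fejer: "summable (\<lambda>k. 2 * \<gamma> * (h (x (Suc k)) - h z))"
      "convergent (\<lambda>k. (norm (x k - z))\<^sup>2)" if z: "z \<in> argmin_set S h" for z
  proof -
    let ?c = "\<lambda>k. (norm (x (Suc k) - x k))\<^sup>2 + 2 * \<gamma> * (D * norm (e k))"
    have zS: "z \<in> S" "\<And>y. y \<in> S \<Longrightarrow> h z \<le> h y" using z by (auto simp: argmin_set_iff)
    have 1: "(norm (x (Suc k) - z))\<^sup>2 \<le> (norm (x k - z))\<^sup>2 - 2 * \<gamma> * (h (x (Suc k)) - h z) + ?c k" for k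
    proof -
      have "(\<gamma> * L - 1) * (norm (x (Suc k) - x k))\<^sup>2 \<le> 1 * (norm (x (Suc k) - x k))\<^sup>2"
        using \<gamma> by (intro mult_right_mono) auto
      moreover have "2 * \<gamma> * (norm (e k) * norm (x (Suc k) - z)) \<le> 2 * \<gamma> * (D * norm (e k))"
        using err[OF zS(1)] \<gamma> by (intro mult_left_mono) auto
      ultimately show ?thesis
        using step_fejer[OF \<gamma>(1) xS step zS(1), of k] by (simp add: algebra_simps)
    qed
    have 2: "0 \<le> (norm (x k - z))\<^sup>2" "0 \<le> 2 * \<gamma> * (h (x (Suc k)) - h z)" "0 \<le> ?c k" for k
      using zS(2)[OF xS] \<gamma> D(1) by auto
    have 3: "summable ?c"
      by (intro summable_add summable_mult sq De)
    show "summable (\<lambda>k. 2 * \<gamma> * (h (x (Suc k)) - h z))" "convergent (\<lambda>k. (norm (x k - z))\<^sup>2)"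
      using quasi_decreasing[of "\<lambda>k. (norm (x k - z))\<^sup>2", OF 1 2 3] .
  qed
  have "(\<lambda>k. h (x (Suc k)) - h z0) \<longlonglongrightarrow> 0"
    using summable_LIMSEQ_zero[OF fejer(1)[OF z0]] \<gamma>(1) tendsto_mult_left_iff[of "2 * \<gamma>" _ 0] by simp
  then have "(\<lambda>k. h (x (Suc k))) \<longlonglongrightarrow> h z0"
    by (simp add: LIM_zero_iff)
  then have hx: "(\<lambda>k. h (x k)) \<longlonglongrightarrow> h z0"
    by (rule LIMSEQ_imp_Suc)
  obtain z r where z: "z \<in> S" "strict_mono r" "(x \<circ> r) \<longlonglongrightarrow> z"
    using S(2) xS unfolding compact_def by metis
  have "(\<lambda>k. h (x (r k))) \<longlonglongrightarrow> h z"
    using continuous_on_tendsto_compose[OF cont z(3,1)] xS by (simp add: o_def)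
  moreover have "(\<lambda>k. h (x (r k))) \<longlonglongrightarrow> h z0"
    using LIMSEQ_subseq_LIMSEQ[OF hx z(2)] by (simp add: o_def)
  ultimately have "h z = h z0"
    by (rule LIMSEQ_unique)
  then have zm: "z \<in> argmin_set S h"
    using z0 z(1) by (auto simp: argmin_set_iff)
  \<comment> \<open>The limit \<open>l\<close> is identified along the subsequence \<open>r\<close>,
    where it must be 0.\<close>
  obtain l where l: "(\<lambda>k. (norm (x k - z))\<^sup>2) \<longlonglongrightarrow> l"
    using fejer(2)[OF zm] by (auto simp: convergent_def)
  moreover have "(\<lambda>k. (norm (x (r k) - z))\<^sup>2) \<longlonglongrightarrow> (norm (z - z))\<^sup>2"
    using z(3) by (intro tendsto_intros) (simp add: o_def)
  ultimately have "l = 0"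
    using LIMSEQ_unique[OF LIMSEQ_subseq_LIMSEQ[OF l z(2)]] by (simp add: o_def)
  then have "(\<lambda>k. norm (x k - z)) \<longlonglongrightarrow> 0"
    using tendsto_real_sqrt[OF l] by simp
  then have "x \<longlonglongrightarrow> z"
    by (simp add: tendsto_norm_zero_iff LIM_zero_iff)
  with zm show ?thesis by (rule that)
qed

text \<open>The potential \<open>W\<close> below decays geometrically and dominates the squared
  steps. So the step lengths, and with them the tails that bound the distance to \<open>z\<close>,
  are geometric.\<close>

theorem weak_sharp_gradient_projection_summable:
  fixes x :: "nat \<Rightarrow> 'a"
  assumes \<gamma>: "0 < \<gamma>" "\<gamma> * L < 2"
    and x0: "x 0 \<in> S"
    and step: "\<And>k. x (Suc k) = closest_point S (x k - \<gamma> *\<^sub>R G (x k))"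
    and ws: "weak_sharp S h"
    and lim: "x \<longlonglongrightarrow> z"
  shows "summable (\<lambda>k. norm (x k - z))"
proof -
  define \<kappa> where "\<kappa> = 1 / \<gamma> - L / 2"
  have \<kappa>: "0 < \<kappa>" using kappa_pos[OF \<gamma>] by (simp add: \<kappa>_def)
  obtain D where D: "0 < D" "\<And>u v. u \<in> S \<Longrightarrow> v \<in> S \<Longrightarrow> norm (u - v) \<le> D"
    by (rule norm_diff_bound) blast
  let ?M = "argmin_set S h"
  obtain z0 where z0: "z0 \<in> ?M" using argmin_nonempty by blast
  obtain \<alpha> where \<alpha>: "0 < \<alpha>" "\<And>t s. t \<in> S \<Longrightarrow> s \<in> ?M \<Longrightarrow> \<alpha> * infdist t ?M \<le> h t - h s"
    using ws by (auto simp: weak_sharp_def)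
  have step': "x (Suc k) = closest_point S (x k - \<gamma> *\<^sub>R (G (x k) + 0))" for k
    using step by simp
  have xS: "x k \<in> S" for k
  proof (induction k)
    case (Suc k) then show ?case using step_in[OF \<gamma>(1) _ step'] by blast
  qed (rule x0)
  define gap where "gap k = h (x k) - h z0" for k
  define d where "d k = infdist (x k) ?M" for k
  \<comment> \<open>The second term absorbs the squared step in \<open>step_fejer\<close>, which by
    \<open>decr\<close> is at most the drop of \<open>gap k / \<kappa>\<close>.\<close>
  define W where "W k = (d k)\<^sup>2 + gap k / \<kappa>" for k
  \<comment> \<open>\<open>D / \<alpha>\<close> comes from
    \<open>d^2 \<le> D * d \<le> D * gap / \<alpha>\<close>, where weak sharpness enters;
    \<open>1 / \<kappa>\<close> comes from the second term of \<open>W\<close>.\<close>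
  define K where "K = D / \<alpha> + 1 / \<kappa>"
  have K: "0 < K" using D \<alpha> \<kappa> by (simp add: K_def add_pos_pos)
  have gap: "0 \<le> gap k" "\<alpha> * d k \<le> gap k" for k
    using z0 \<alpha>(2)[OF xS z0] xS by (auto simp: gap_def d_def argmin_set_iff)
  have W_nonneg: "0 \<le> W k" for k
    using gap \<kappa> by (simp add: W_def)
  have decr: "\<kappa> * (norm (x (Suc k) - x k))\<^sup>2 \<le> gap k - gap (Suc k)" for k
    using step_descent[OF \<gamma>(1) xS step', of k] by (simp add: gap_def \<kappa>_def)
  have W_le: "W k \<le> K * gap k" for k
  proof -
    have "d k \<le> D"
      using infdist_le[OF z0, of "x k"] D(2)[OF xS, of z0 k] z0
      by (simp add: d_def dist_norm argmin_set_iff)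
    then have "(d k)\<^sup>2 \<le> D * d k"
      by (simp add: power2_eq_square mult_right_mono d_def infdist_nonneg)
    also have "\<dots> \<le> D * (gap k / \<alpha>)"
      using gap(2)[of k] \<alpha>(1) D(1) by (intro mult_left_mono) (auto simp: field_simps)
    finally show ?thesis by (simp add: W_def K_def algebra_simps)
  qed
  have W_Suc: "W (Suc k) \<le> W k - 2 * \<gamma> * gap (Suc k)" for k
  proof -
    \<comment> \<open>The minimizer nearest to \<open>x k\<close> makes the old distance exactly
      \<open>d k\<close>, while it still bounds \<open>d (Suc k)\<close> from above.\<close>
    obtain p where p: "p \<in> ?M" "d k = dist (x k) p"
      using infdist_attains_inf[OF closed_argmin argmin_nonempty] by (auto simp: d_def)
    then have pS: "p \<in> S" "h p = h z0" using z0 by (auto simp: argmin_set_iff intro: antisym)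
    have "(d (Suc k))\<^sup>2 \<le> (norm (x (Suc k) - p))\<^sup>2"
      using infdist_le[OF p(1), of "x (Suc k)"]
      by (intro power_mono) (auto simp: d_def infdist_nonneg dist_norm)
    moreover have "(\<gamma> * L - 1) * (norm (x (Suc k) - x k))\<^sup>2 \<le> 1 * (norm (x (Suc k) - x k))\<^sup>2"
      using \<gamma> by (intro mult_right_mono) auto
    moreover have "(norm (x (Suc k) - x k))\<^sup>2 \<le> (gap k - gap (Suc k)) / \<kappa>"
      using decr[of k] \<kappa> by (simp add: field_simps)
    ultimately show ?thesis
      using step_fejer[OF \<gamma>(1) xS step' pS(1), of k] pS(2) p(2)
      by (simp add: W_def gap_def dist_norm algebra_simps diff_divide_distrib)
  qed
  \<comment> \<open>The gap in \<open>W_Suc\<close> sits at the new index, so \<open>W_le\<close>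
    moves a multiple of \<open>W (Suc k)\<close> to the left-hand side and the factor is
    automatically below 1.\<close>
  define \<rho> where "\<rho> = 1 / (1 + 2 * \<gamma> / K)"
  have \<rho>: "0 < \<rho>" "\<rho> < 1" using \<gamma> K by (auto simp: \<rho>_def add_pos_pos)
  have W_geo: "W (Suc k) \<le> \<rho> * W k" for k
  proof -
    have "2 * \<gamma> / K * W (Suc k) \<le> 2 * \<gamma> * gap (Suc k)"
      using W_le[of "Suc k"] \<gamma> K by (simp add: field_simps)
    then have "(1 + 2 * \<gamma> / K) * W (Suc k) \<le> W k"
      using W_Suc[of k] by (simp add: algebra_simps)
    moreover have "0 < 1 + 2 * \<gamma> / K" using \<gamma> K by (simp add: add_pos_pos)
    ultimately show ?thesis by (simp add: \<rho>_def field_simps)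
  qed
  have W_pow: "W k \<le> \<rho> ^ k * W 0" for k
  proof (induction k)
    case (Suc k)
    have "\<rho> * W k \<le> \<rho> * (\<rho> ^ k * W 0)"
      using Suc \<rho> by (intro mult_left_mono) auto
    with W_geo[of k] show ?case by (simp add: mult.assoc)
  qed simp
  define q where "q = sqrt \<rho>"
  define B where "B = sqrt (W 0)"
  have q: "0 < q" "q < 1" using \<rho> by (auto simp: q_def)
  have inc: "norm (x (Suc k) - x k) \<le> B * q ^ k" for k
  proof -
    have "(norm (x (Suc k) - x k))\<^sup>2 \<le> gap k / \<kappa>"
      using decr[of k] gap(1)[of "Suc k"] \<kappa> by (simp add: field_simps)
    also have "\<dots> \<le> W k" by (simp add: W_def)
    also have "\<dots> \<le> \<rho> ^ k * W 0" by (rule W_pow)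
    finally have "norm (x (Suc k) - x k) \<le> sqrt (\<rho> ^ k * W 0)"
      by (rule real_le_rsqrt)
    then show ?thesis by (simp add: B_def q_def real_sqrt_mult real_sqrt_power mult.commute)
  qed
  have "norm (x k - x (k + n)) \<le> B * q ^ k / (1 - q)" for k n
  proof -
    \<comment> \<open>The exact geometric partial sum is what the induction on \<open>n\<close> can
      carry; the bound uniform in \<open>n\<close> follows afterwards.\<close>
    have "norm (x k - x (k + n)) \<le> B * q ^ k * (1 - q ^ n) / (1 - q)"
    proof (induction n)
      case (Suc n)
      have "norm (x k - x (k + Suc n)) \<le> norm (x k - x (k + n)) + norm (x (Suc (k + n)) - x (k + n))"
        using norm_triangle_ineq4[of "x k - x (k + n)" "x (Suc (k + n)) - x (k + n)"] by simp
      also have "\<dots> \<le> B * q ^ k * (1 - q ^ n) / (1 - q) + B * q ^ (k + n)"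
        using Suc inc by (intro add_mono)
      also have "\<dots> = B * q ^ k * (1 - q ^ Suc n) / (1 - q)"
        using q by (simp add: field_simps power_add)
      finally show ?case .
    qed simp
    also have "\<dots> \<le> B * q ^ k * 1 / (1 - q)"
      using q W_nonneg[of 0] by (intro divide_right_mono mult_left_mono) (auto simp: B_def)
    finally show ?thesis by simp
  qed
  moreover have "(\<lambda>n. norm (x k - x (k + n))) \<longlonglongrightarrow> norm (x k - z)" for k
    using LIMSEQ_ignore_initial_segment[OF lim, of k] by (intro tendsto_intros) (simp add: add.commute)
  ultimately have bound: "norm (x k - z) \<le> B / (1 - q) * q ^ k" for k
    using LIMSEQ_le_const2[of "\<lambda>n. norm (x k - x (k + n))" "norm (x k - z)" "B / (1 - q) * q ^ k"] by simp
  show ?thesis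
    by (rule summable_comparison_test'[of "\<lambda>k. B / (1 - q) * q ^ k" 0])
      (use q bound in \<open>auto intro!: summable_mult summable_geometric\<close>)
qed

end

section \<open>The joint scheme\<close>

theorem proposition9:
  fixes X :: "(real ^ 'n) set"
    and \<Theta> :: "(real ^ 'm) set"
    and f :: "real ^ 'n \<Rightarrow> real ^ 'm \<Rightarrow> real"
    and g :: "real ^ 'm \<Rightarrow> real"
    and grad_f :: "real ^ 'n \<Rightarrow> real ^ 'm \<Rightarrow> real ^ 'n"
    and grad_g :: "real ^ 'm \<Rightarrow> real ^ 'm"
    and G_fx G_f\<theta> G_g \<gamma>f \<gamma>g :: real
    and x :: "nat \<Rightarrow> real ^ 'n"
    and \<theta> :: "nat \<Rightarrow> real ^ 'm"
  assumes "X \<noteq> {}" "closed X" "convex X" "compact X"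
    and "\<Theta> \<noteq> {}" "closed \<Theta>" "convex \<Theta>" "compact \<Theta>"
    and "\<And>t. t \<in> \<Theta> \<Longrightarrow> convex_on X (\<lambda>u. f u t)"
    and "convex_on UNIV g"
    and "\<And>t. t \<in> \<Theta> \<Longrightarrow> C1_with_gradient_on X (\<lambda>u. f u t) (\<lambda>u. grad_f u t)"
    and "C1_with_gradient_on UNIV g grad_g"
    and "\<And>u v t. u \<in> X \<Longrightarrow> v \<in> X \<Longrightarrow> t \<in> \<Theta> \<Longrightarrow>
           norm (grad_f u t - grad_f v t) \<le> G_fx * norm (u - v)"
    and "G_g-lipschitz_on UNIV grad_g"
    and "\<And>u s t. u \<in> X \<Longrightarrow> s \<in> \<Theta> \<Longrightarrow> t \<in> \<Theta> \<Longrightarrow>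
           norm (grad_f u s - grad_f u t) \<le> G_f\<theta> * norm (s - t)"
    and "weak_sharp \<Theta> g"
    and "0 < \<gamma>f" "\<gamma>f < 2 / G_fx"
    and "0 < \<gamma>g" "\<gamma>g < 2 / G_g"
    and "joint_gradient_scheme X \<Theta> grad_f grad_g (\<lambda>_. \<gamma>f) (\<lambda>_. \<gamma>g) x \<theta>"
  shows "\<exists>\<theta>s \<in> argmin_set \<Theta> g. \<theta> \<longlonglongrightarrow> \<theta>s \<and>
           (\<exists>xs \<in> argmin_set X (\<lambda>u. f u \<theta>s). x \<longlonglongrightarrow> xs)"
proof -
  have \<gamma>L: "\<gamma> * L < 2" if "0 < \<gamma>" "\<gamma> < 2 / L" for \<gamma> L :: real
  proof -
    \<comment> \<open>Positivity of \<open>2 / L\<close> also excludes \<open>L = 0\<close>, since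
      \<open>2 / 0 = 0\<close>.\<close>
    have "0 < 2 / L" using that by linarith
    then have "0 < L" by (simp add: zero_less_divide_iff)
    then show ?thesis using that(2) by (simp add: field_simps)
  qed
  have x0: "x 0 \<in> X" and \<theta>0: "\<theta> 0 \<in> \<Theta>"
    and x_step: "\<And>k. x (Suc k) = closest_point X (x k - \<gamma>f *\<^sub>R grad_f (x k) (\<theta> k))"
    and \<theta>_step: "\<And>k. \<theta> (Suc k) = closest_point \<Theta> (\<theta> k - \<gamma>g *\<^sub>R grad_g (\<theta> k))"
    using assms(21) by (auto simp: joint_gradient_scheme_def)
  interpret g: smooth_convex \<Theta> g grad_g G_g
  proof
    show "convex_on \<Theta> g"
      using assms(7,10) by (rule convex_on_subset[rotated 2]) simp
    show "(g has_derivative (\<lambda>v. grad_g u \<bullet> v)) (at u within \<Theta>)" for u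
      using assms(12) by (auto simp: C1_with_gradient_on_def intro: has_derivative_at_withinI)
    show "norm (grad_g u - grad_g v) \<le> G_g * norm (u - v)" for u v
      using lipschitz_onD[OF assms(14), of u v] by (simp add: dist_norm)
  qed (rule assms)+
  \<comment> \<open>The \<theta>-iteration does not depend on \<open>x\<close> and is the case of
    zero error.\<close>
  obtain \<theta>s where \<theta>s: "\<theta>s \<in> argmin_set \<Theta> g" "\<theta> \<longlonglongrightarrow> \<theta>s"
    by (rule g.perturbed_gradient_projection_converges[where x = \<theta> and e = "\<lambda>_. 0",
          OF assms(19) \<gamma>L[OF assms(19,20)] \<theta>0]) (auto simp: \<theta>_step)
  have summ: "summable (\<lambda>k. norm (\<theta> k - \<theta>s))"
    using g.weak_sharp_gradient_projection_summable[OF assms(19) \<gamma>L[OF assms(19,20)] \<theta>0 \<theta>_step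
        assms(16) \<theta>s(2)] .
  have \<theta>s_in: "\<theta>s \<in> \<Theta>" using \<theta>s(1) by (simp add: argmin_set_iff)
  \<comment> \<open>The parameter is frozen at its limit; using \<theta>_k instead is treated as a
    gradient error.\<close>
  interpret f: smooth_convex X "\<lambda>u. f u \<theta>s" "\<lambda>u. grad_f u \<theta>s" G_fx
  proof
    show "((\<lambda>u. f u \<theta>s) has_derivative (\<lambda>v. grad_f u \<theta>s \<bullet> v)) (at u within X)" if "u \<in> X" for u
      using assms(11)[OF \<theta>s_in] that by (simp add: C1_with_gradient_on_def)
  qed (rule assms \<theta>s_in | assumption)+
  have xX: "x k \<in> X" for k
    by (cases k) (simp_all add: x0 x_step closest_point_in_set assms(1,2))
  have \<theta>\<Theta>: "\<theta> k \<in> \<Theta>" for k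
    by (cases k) (simp_all add: \<theta>0 \<theta>_step closest_point_in_set assms(5,6))
  \<comment> \<open>Lipschitz dependence on the parameter bounds this error by a multiple of the
    distance from \<theta>_k to \<open>\<theta>s\<close>, which is summable by
    \<open>summ\<close>.\<close>
  let ?e = "\<lambda>k. grad_f (x k) (\<theta> k) - grad_f (x k) \<theta>s"
  have "summable (\<lambda>k. norm (?e k))"
  proof (rule summable_comparison_test')
    show "summable (\<lambda>k. G_f\<theta> * norm (\<theta> k - \<theta>s))" using summ by (rule summable_mult)
    show "norm (norm (?e k)) \<le> G_f\<theta> * norm (\<theta> k - \<theta>s)" if "k \<ge> 0" for k
      using assms(15)[OF xX \<theta>\<Theta> \<theta>s_in] by simp
  qed
  then obtain xs where "xs \<in> argmin_set X (\<lambda>u. f u \<theta>s)" "x \<longlonglongrightarrow> xs"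
    by (rule f.perturbed_gradient_projection_converges[where x = x, OF assms(17) \<gamma>L[OF assms(17,18)] x0, rotated])
      (auto simp: x_step)
  with \<theta>s show ?thesis by blast
qed

end
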